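(* Let $r\geq 3$ and $\Delta\geq 1$ be integers, and let $G$ be an $r$-uniform hypergraph with maximum degree $\Delta$. Then $$\chi_{\mathrm{ch}}(G)\leq c:=\left\lceil \Big(\frac{r-1}{r-2}\Big)\big((r-2)\Delta\big)^{1/(r-1)}\right\rceil.$$ Moreover, for every $c$-list-assignment $L$ of $G$, the number $P(G,L)$ of proper $L$-colourings of $G$ satisfies $$P(G,L)\geq \big((r-2)\Delta\big)^{|V(G)|/(r-1)}.$$
   Context: All hypergraphs are finite. A hypergraph $G$ consists of a vertex set $V(G)$ and a set $E(G)$ of edges, each a subset of $V(G)$; it is $r$-uniform if every edge has exactly $r$ vertices. The degree of a vertex is the number of edges containing it. A list-assignment $L$ of $G$ assigns to each vertex $v$ a set $L(v)$ of colours; it is a $c$-list-assignment if $|L(v)|=c$ for all $v$. An $L$-colouring is a function $\phi$ on $V(G)$ with $\phi(v)\in L(v)$ for all $v$. A colouring is proper if no edge is monochromatic. The choosability $\chi_{\mathrm{ch}}(G)$ is the minimum integer $c$ such that $G$ has a proper $L$-colouring for every $c$-list-assignment $L$. *)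

theory Defs
  imports "HOL-Analysis.Analysis"
begin

text \<open>A hypergraph is given by its vertex set \<open>V\<close> and its edge set \<open>E\<close>; multiple edges
  do not occur.\<close>

definition hypergraph :: "'v set \<Rightarrow> 'v set set \<Rightarrow> bool" where
  "hypergraph V E \<longleftrightarrow> finite V \<and> (\<forall>e\<in>E. e \<subseteq> V)"

definition uniform :: "nat \<Rightarrow> 'v set set \<Rightarrow> bool" where
  "uniform r E \<longleftrightarrow> (\<forall>e\<in>E. card e = r)"

definition degree :: "'v set set \<Rightarrow> 'v \<Rightarrow> nat" where
  "degree E v = card {e \<in> E. v \<in> e}"

text \<open>Inserting \<open>0\<close> only matters for \<open>V = {}\<close>, where \<open>Max {}\<close> would be unspecified.\<close>

definition max_degree :: "'v set \<Rightarrow> 'v set set \<Rightarrow> nat" where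
  "max_degree V E = Max (insert 0 (degree E ` V))"

text \<open>Finiteness of the lists is required separately because \<open>card\<close> is \<open>0\<close> on infinite sets.
  Only the values of \<open>L\<close> on \<open>V\<close> are relevant.\<close>

definition list_assignment :: "'v set \<Rightarrow> nat \<Rightarrow> ('v \<Rightarrow> 'c set) \<Rightarrow> bool" where
  "list_assignment V c L \<longleftrightarrow> (\<forall>v\<in>V. finite (L v) \<and> card (L v) = c)"

definition monochromatic :: "('v \<Rightarrow> 'c) \<Rightarrow> 'v set \<Rightarrow> bool" where
  "monochromatic \<phi> e \<longleftrightarrow> (\<exists>k. \<forall>v\<in>e. \<phi> v = k)"

text \<open>Colourings are functions on \<open>V\<close>, hence extensional outside \<open>V\<close>; otherwise they could
  not be counted.\<close>

definition proper_colourings ::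
    "'v set \<Rightarrow> 'v set set \<Rightarrow> ('v \<Rightarrow> 'c set) \<Rightarrow> ('v \<Rightarrow> 'c) set" where
  "proper_colourings V E L = {\<phi> \<in> Pi\<^sub>E V L. \<forall>e\<in>E. \<not> monochromatic \<phi> e}"

definition num_proper_colourings ::
    "'v set \<Rightarrow> 'v set set \<Rightarrow> ('v \<Rightarrow> 'c set) \<Rightarrow> nat" where
  "num_proper_colourings V E L = card (proper_colourings V E L)"

text \<open>A definition cannot quantify over colour types, so colours are natural numbers here.
  For finite hypergraphs this is no restriction, as \<open>choosable_any_colours\<close> shows.\<close>

definition choosable :: "'v set \<Rightarrow> 'v set set \<Rightarrow> nat \<Rightarrow> bool" where
  "choosable V E c \<longleftrightarrow>
    (\<forall>L :: 'v \<Rightarrow> nat set. list_assignment V c L \<longrightarrow> proper_colourings V E L \<noteq> {})"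

definition choosability :: "'v set \<Rightarrow> 'v set set \<Rightarrow> nat" where
  "choosability V E = (LEAST c. choosable V E c)"

lemma choosable_any_colours:
  fixes L :: "'v \<Rightarrow> 'c set"
  assumes H: "hypergraph V E" and C: "choosable V E c" and L: "list_assignment V c L"
  shows "proper_colourings V E L \<noteq> {}"
proof -
  define U where "U = (\<Union>v\<in>V. L v)"
  have "finite U"
    using H L by (auto simp: U_def hypergraph_def list_assignment_def)
  then obtain f :: "'c \<Rightarrow> nat" where f: "inj_on f U"
    using finite_imp_inj_to_nat_seg by metis
  have sub: "L v \<subseteq> U" if "v \<in> V" for v
    using that by (auto simp: U_def)
  have "list_assignment V c (\<lambda>v. f ` L v)"
    using L card_image[OF inj_on_subset[OF f sub]] by (auto simp: list_assignment_def)
  then obtain \<psi> where \<psi>: "\<psi> \<in> proper_colourings V E (\<lambda>v. f ` L v)"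
    using C by (auto simp: choosable_def)
  then have "\<forall>v\<in>V. \<exists>k. k \<in> L v \<and> f k = \<psi> v"
    by (fastforce simp: proper_colourings_def PiE_iff)
  then obtain g where g: "\<And>v. v \<in> V \<Longrightarrow> g v \<in> L v \<and> f (g v) = \<psi> v"
    by metis
  have "\<not> monochromatic (restrict g V) e" if e: "e \<in> E" for e
  proof
    assume "monochromatic (restrict g V) e"
    then obtain k where k: "\<And>v. v \<in> e \<Longrightarrow> restrict g V v = k"
      by (auto simp: monochromatic_def)
    have "\<psi> v = f k" if "v \<in> e" for v
    proof -
      have "v \<in> V" using H e that by (auto simp: hypergraph_def)
      then show ?thesis using g[of v] k[OF that] by simp
    qed
    then have "monochromatic \<psi> e"
      by (auto simp: monochromatic_def)
    then show False
      using \<psi> e by (auto simp: proper_colourings_def)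
  qed
  then have "restrict g V \<in> proper_colourings V E L"
    using g by (auto simp: proper_colourings_def)
  then show ?thesis by blast
qed

end

theory Submission
  imports Defs
begin

text \<open>
  Deleting a vertex from an induced subhypergraph divides the number of proper colourings by at
  least \<open>\<beta> = ((r - 2) \<Delta>)\<^bsup>1/(r-1)\<^esup>\<close>; this is shown by induction on the number of vertices.
  Extending a proper colouring of \<open>S - {v}\<close> to \<open>v\<close> in all \<open>c\<close> ways gives \<open>c P(S - {v})\<close>
  colourings. If such a colouring is monochromatic on an edge \<open>e\<close> containing \<open>v\<close>, it is determined
  by its restriction to \<open>S - (e - {w})\<close> for any \<open>w \<in> e - {v}\<close>, since \<open>w\<close> still shows the colour of
  \<open>e\<close>. By induction there are at most \<open>P(S - {v}) / \<beta>\<^bsup>r-2\<^esup>\<close> of these, whence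
  \<open>P(S) \<ge> (c - \<Delta> / \<beta>\<^bsup>r-2\<^esup>) P(S - {v}) \<ge> \<beta> P(S - {v})\<close>.
\<close>

definition induced_edges :: "'v set set \<Rightarrow> 'v set \<Rightarrow> 'v set set" where
  "induced_edges E S = {e \<in> E. e \<subseteq> S}"

abbreviation induced_colourings ::
    "'v set set \<Rightarrow> ('v \<Rightarrow> 'c set) \<Rightarrow> 'v set \<Rightarrow> ('v \<Rightarrow> 'c) set" where
  "induced_colourings E L S \<equiv> proper_colourings S (induced_edges E S) L"

lemma monochromatic_cong:
  assumes "\<And>v. v \<in> e \<Longrightarrow> \<phi> v = \<psi> v"
  shows "monochromatic \<phi> e \<longleftrightarrow> monochromatic \<psi> e"
  using assms by (auto simp: monochromatic_def)

lemma finite_proper_colourings: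
  assumes "finite S" "\<And>v. v \<in> S \<Longrightarrow> finite (L v)"
  shows "finite (proper_colourings S F L)"
  using finite_PiE[of S L] assms unfolding proper_colourings_def by auto

lemma restrict_induced_colourings:
  assumes "\<psi> \<in> induced_colourings E L S" "T \<subseteq> S"
  shows "restrict \<psi> T \<in> induced_colourings E L T"
proof -
  have "\<not> monochromatic (restrict \<psi> T) e" if "e \<in> E" "e \<subseteq> T" for e
  proof -
    have "\<not> monochromatic \<psi> e"
      using assms that by (auto simp: proper_colourings_def induced_edges_def)
    moreover have "monochromatic (restrict \<psi> T) e \<longleftrightarrow> monochromatic \<psi> e"
      using that by (intro monochromatic_cong) auto
    ultimately show ?thesis by simp
  qed
  then show ?thesis
    using assms by (auto simp: proper_colourings_def induced_edges_def PiE_iff)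
qed

text \<open>Restriction to \<open>S - (e - {w})\<close> is injective here, as \<open>w\<close> is
  the one vertex of \<open>e\<close> that survives and it carries the common colour. The counted
  extensions need not be proper on \<open>S\<close>. The condition \<open>w \<noteq> v\<close> makes
  the smaller set avoid \<open>v\<close>, so that properness on \<open>S - {v}\<close>
  suffices.\<close>

lemma card_monochromatic_extensions_le:
  assumes fin: "finite S" "\<And>v. v \<in> S \<Longrightarrow> finite (L v)"
    and e: "e \<subseteq> S" "v \<in> e" "w \<in> e" "w \<noteq> v"
  shows "card {\<psi> \<in> Pi\<^sub>E S L. restrict \<psi> (S - {v}) \<in> induced_colourings E L (S - {v}) \<and>
                            monochromatic \<psi> e}
         \<le> card (induced_colourings E L (S - (e - {w})))" (is "card ?B \<le> card ?C")
proof (rule card_inj_on_le)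
  let ?T = "S - (e - {w})"
  show "inj_on (\<lambda>\<psi>. restrict \<psi> ?T) ?B"
  proof (rule inj_onI)
    fix \<phi> \<psi> assume \<phi>: "\<phi> \<in> ?B" and \<psi>: "\<psi> \<in> ?B"
      and eq: "restrict \<phi> ?T = restrict \<psi> ?T"
    have on_T: "\<phi> x = \<psi> x" if "x \<in> ?T" for x
      using fun_cong[OF eq, of x] that by simp
    have "\<phi> x = \<psi> x" if "x \<in> e" for x
    proof -
      have "\<phi> x = \<phi> w" "\<psi> x = \<psi> w"
        using \<phi> \<psi> that e(3) unfolding monochromatic_def by force+
      moreover have "\<phi> w = \<psi> w"
        using on_T[of w] e by blast
      ultimately show ?thesis by simp
    qed
    then show "\<phi> = \<psi>"
      using \<phi> \<psi> on_T by (intro PiE_ext[of \<phi> S L \<psi>]) auto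
  qed
  show "(\<lambda>\<psi>. restrict \<psi> ?T) ` ?B \<subseteq> ?C"
  proof (rule image_subsetI)
    fix \<psi> assume "\<psi> \<in> ?B"
    then have "restrict \<psi> (S - {v}) \<in> induced_colourings E L (S - {v})"
      by blast
    \<comment> \<open>Properness is known only on \<open>S - {v}\<close>, hence the detour through
      two restrictions; \<open>?T\<close> lies in \<open>S - {v}\<close> because \<open>v\<close>
      belongs to \<open>e - {w}\<close>.\<close>
    then have "restrict (restrict \<psi> (S - {v})) ?T \<in> ?C"
      using e by (elim restrict_induced_colourings) auto
    moreover have "restrict (restrict \<psi> (S - {v})) ?T = restrict \<psi> ?T"
      using e by (auto simp: fun_eq_iff restrict_def)
    ultimately show "restrict \<psi> ?T \<in> ?C" by simp
  qed
  show "finite ?C"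
    using fin by (intro finite_proper_colourings) auto
qed

text \<open>A union bound. The pairs of a proper colouring of \<open>S - {v}\<close> and a colour in
  \<open>L v\<close> embed into the colourings of \<open>S\<close>. An extension can fail to be
  proper only at an edge through \<open>v\<close>, since the other edges inside \<open>S\<close> lie
  inside \<open>S - {v}\<close>.\<close>

lemma card_extensions_le:
  assumes fin: "finite S" "\<And>v. v \<in> S \<Longrightarrow> finite (L v)" and v: "v \<in> S"
  shows "card (L v) * card (induced_colourings E L (S - {v}))
         \<le> card (induced_colourings E L S) +
           (\<Sum>e\<in>{e \<in> induced_edges E S. v \<in> e}.
              card {\<psi> \<in> Pi\<^sub>E S L. restrict \<psi> (S - {v}) \<in> induced_colourings E L (S - {v}) \<and>
                                monochromatic \<psi> e})"
    (is "_ * card ?P \<le> card ?Q + sum (\<lambda>e. card (?B e)) ?F")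
proof -
  have finF: "finite ?F"
    using fin(1) by (auto simp: induced_edges_def intro: finite_subset[of _ "Pow S"])
  have finB: "finite (?B e)" for e
    using finite_PiE[of S L] fin by auto
  have finQ: "finite ?Q"
    using fin by (intro finite_proper_colourings)
  let ?ext = "\<lambda>(\<phi>, k). \<phi>(v := k)"
  have "inj_on ?ext (?P \<times> L v)"
  proof (rule inj_onI, clarify)
    fix \<phi> k \<phi>' k'
    assume \<phi>: "\<phi> \<in> ?P" "\<phi>' \<in> ?P" and eq: "\<phi>(v := k) = \<phi>'(v := k')"
    have "\<phi> x = \<phi>' x" if "x \<in> S - {v}" for x
      using fun_cong[OF eq, of x] that by simp
    then have "\<phi> = \<phi>'"
      using \<phi> by (intro PiE_ext[of \<phi> "S - {v}" L \<phi>']) (auto simp: proper_colourings_def)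
    then show "\<phi> = \<phi>' \<and> k = k'"
      using fun_cong[OF eq, of v] by simp
  qed
  moreover have "?ext ` (?P \<times> L v) \<subseteq> ?Q \<union> (\<Union>e\<in>?F. ?B e)"
  proof (rule image_subsetI, clarify)
    fix \<phi> k
    assume \<phi>: "\<phi> \<in> ?P" and k: "k \<in> L v"
      and no: "\<phi>(v := k) \<notin> (\<Union>e\<in>?F. ?B e)"
    let ?\<psi> = "\<phi>(v := k)"
    have \<phi>_PiE: "\<phi> \<in> Pi\<^sub>E (S - {v}) L"
      using \<phi> by (simp add: proper_colourings_def)
    have PiE: "?\<psi> \<in> Pi\<^sub>E S L"
      using \<phi>_PiE k v by (auto simp: PiE_iff extensional_def)
    have restr: "restrict ?\<psi> (S - {v}) = \<phi>"
      using \<phi>_PiE by (auto simp: PiE_iff extensional_def fun_eq_iff)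
    have "\<not> monochromatic ?\<psi> e" if e: "e \<in> induced_edges E S" for e
    proof (cases "v \<in> e")
      case True
      then show ?thesis using no e PiE restr \<phi> by auto
    next
      case False
      then have "e \<in> induced_edges E (S - {v})"
        using e by (auto simp: induced_edges_def)
      then have "\<not> monochromatic \<phi> e"
        using \<phi> by (simp add: proper_colourings_def)
      moreover have "monochromatic ?\<psi> e \<longleftrightarrow> monochromatic \<phi> e"
        using False by (intro monochromatic_cong) auto
      ultimately show ?thesis by simp
    qed
    then show "?\<psi> \<in> ?Q"
      using PiE by (simp add: proper_colourings_def)
  qed
  moreover have "finite (?Q \<union> (\<Union>e\<in>?F. ?B e))"
    using finQ finF finB by blast
  ultimately have "card (?P \<times> L v) \<le> card (?Q \<union> (\<Union>e\<in>?F. ?B e))"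
    by (rule card_inj_on_le)
  also have "\<dots> \<le> card ?Q + card (\<Union>e\<in>?F. ?B e)"
    by (rule card_Un_le)
  also have "\<dots> \<le> card ?Q + sum (\<lambda>e. card (?B e)) ?F"
    using card_UN_le[OF finF] by (intro add_left_mono)
  finally show ?thesis
    by (simp add: card_cartesian_product mult.commute)
qed

text \<open>An arbitrary set \<open>T\<close> is deleted, not just one vertex, because the bound for
  a bad edge deletes \<open>r - 2\<close> further vertices at once. The second condition on \<beta>
  is c \<ge> \<beta> + \<Delta> / \<beta>^(r-2) with denominators cleared.\<close>

lemma card_induced_colourings_diff:
  fixes \<beta> :: real and L :: "'v \<Rightarrow> 'c set"
  assumes H: "hypergraph V E" "uniform r E" "list_assignment V c L"
    and deg: "\<And>v. v \<in> V \<Longrightarrow> degree E v \<le> \<Delta>"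
    and r: "r \<ge> 2" and \<beta>: "\<beta> > 0" "\<beta> ^ (r - 1) + real \<Delta> \<le> real c * \<beta> ^ (r - 2)"
    and S: "S \<subseteq> V" "T \<subseteq> S"
  shows "\<beta> ^ card T * card (induced_colourings E L (S - T)) \<le> card (induced_colourings E L S)"
proof -
  have "finite S"
    using S H(1) by (auto simp: hypergraph_def intro: finite_subset)
  then show ?thesis using S
  proof (induction S arbitrary: T rule: finite_psubset_induct)
    case (psubset S)
    have finL: "\<And>v. v \<in> S \<Longrightarrow> finite (L v)"
      using psubset.prems(1) H(3) by (auto simp: list_assignment_def)
    show ?case
    proof (cases "T = {}")
      case False
      then obtain v where v: "v \<in> T" by blast
      define P where "P S = real (card (induced_colourings E L S))" for S
      let ?F = "{e \<in> induced_edges E S. v \<in> e}"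
      define B where "B e = real (card {\<psi> \<in> Pi\<^sub>E S L.
          restrict \<psi> (S - {v}) \<in> induced_colourings E L (S - {v}) \<and> monochromatic \<psi> e})" for e
      have vS: "v \<in> S" "v \<in> V" using v psubset.prems by auto
      \<comment> \<open>The induction hypothesis is used only at \<open>S - {v}\<close>, but for two
        choices of \<open>U\<close>: \<open>e - {v} - {w}\<close> for a bad edge, and
        \<open>T - {v}\<close> at the end.\<close>
      have IH: "\<beta> ^ card U * P (S - {v} - U) \<le> P (S - {v})" if "U \<subseteq> S - {v}" for U
        unfolding P_def using psubset.IH[of "S - {v}" U] that vS psubset.prems by blast
      have bad: "\<beta> ^ (r - 2) * B e \<le> P (S - {v})" if e: "e \<in> ?F" for e
      proof -
        have e': "e \<subseteq> S" "v \<in> e" "card e = r"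
          using e H(2) by (auto simp: induced_edges_def uniform_def)
        have "finite e" using e' psubset.hyps finite_subset by blast
        then have ce: "card (e - {v}) = r - 1" using e' by simp
        then have "e - {v} \<noteq> {}" using r by (intro notI) simp
        then obtain w where w: "w \<in> e" "w \<noteq> v" by blast
        have cU: "card (e - {v} - {w}) = r - 2"
          using ce w \<open>finite e\<close> by simp
        have "B e \<le> P (S - (e - {w}))"
          using card_monochromatic_extensions_le[OF psubset.hyps finL e'(1,2) w]
          unfolding B_def P_def by (rule of_nat_mono)
        also have "S - (e - {w}) = S - {v} - (e - {v} - {w})"
          using w e' by auto
        finally have "\<beta> ^ (r - 2) * B e
            \<le> \<beta> ^ card (e - {v} - {w}) * P (S - {v} - (e - {v} - {w}))"
          unfolding cU by (rule mult_left_mono) (use \<beta>(1) in simp)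
        also have "\<dots> \<le> P (S - {v})"
          using e' by (intro IH) auto
        finally show ?thesis .
      qed
      have finE: "finite E"
        using H(1) by (auto simp: hypergraph_def intro: finite_subset[of E "Pow V"])
      have "card ?F \<le> degree E v"
        unfolding degree_def using finE by (intro card_mono) (auto simp: induced_edges_def)
      then have cF: "card ?F \<le> \<Delta>" using deg[OF vS(2)] by simp
      have cL: "card (L v) = c" using H(3) vS by (simp add: list_assignment_def)
      have "real c * P (S - {v}) \<le> P S + (\<Sum>e\<in>?F. B e)"
        using of_nat_mono[OF card_extensions_le[of S L v E, OF psubset.hyps finL vS(1)],
            where 'a = real]
        by (simp only: B_def P_def cL of_nat_add of_nat_mult of_nat_sum)
      then have "\<beta> ^ (r - 2) * (real c * P (S - {v}))
          \<le> \<beta> ^ (r - 2) * (P S + (\<Sum>e\<in>?F. B e))"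
        using \<beta> by (intro mult_left_mono) auto
      also have "\<dots> = \<beta> ^ (r - 2) * P S + (\<Sum>e\<in>?F. \<beta> ^ (r - 2) * B e)"
        by (simp add: distrib_left sum_distrib_left)
      also have "(\<Sum>e\<in>?F. \<beta> ^ (r - 2) * B e) \<le> real (card ?F) * P (S - {v})"
        using bad by (intro sum_bounded_above) auto
      also have "\<dots> \<le> real \<Delta> * P (S - {v})"
        using cF by (intro mult_right_mono) (auto simp: P_def)
      finally have 1: "\<beta> ^ (r - 2) * (real c * P (S - {v}))
          \<le> \<beta> ^ (r - 2) * P S + real \<Delta> * P (S - {v})"
        by simp
      \<comment> \<open>The condition on \<beta> is scaled by \<open>P (S - {v})\<close>; the loss
        from bad edges then cancels against the \<Delta> term, and dividing by \<beta>^(r-2) leaves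
        the one-vertex bound.\<close>
      have "(\<beta> ^ (r - 1) + real \<Delta>) * P (S - {v}) \<le> real c * \<beta> ^ (r - 2) * P (S - {v})"
        using \<beta>(2) by (intro mult_right_mono) (auto simp: P_def)
      then have "\<beta> ^ (r - 1) * P (S - {v}) \<le> \<beta> ^ (r - 2) * P S"
        using 1 by (simp add: algebra_simps)
      moreover have "\<beta> ^ (r - 1) = \<beta> ^ (r - 2) * \<beta>"
      proof -
        have "r - 1 = Suc (r - 2)" using r by simp
        then show ?thesis by (simp only: power_Suc2)
      qed
      ultimately have step: "\<beta> * P (S - {v}) \<le> P S"
        using \<beta>(1) by (simp add: mult.assoc)
      have "finite T" using psubset.prems psubset.hyps finite_subset by blast
      then have "card T = Suc (card (T - {v}))"
        using v by (rule card.remove)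
      moreover have "S - T = S - {v} - (T - {v})" using v by auto
      ultimately have "\<beta> ^ card T * P (S - T)
          = \<beta> * (\<beta> ^ card (T - {v}) * P (S - {v} - (T - {v})))"
        by (simp only: power_Suc mult.assoc)
      also have "\<dots> \<le> \<beta> * P (S - {v})"
        using \<beta> psubset.prems by (intro mult_left_mono IH) auto
      also have "\<dots> \<le> P S" by (rule step)
      finally show ?thesis unfolding P_def .
    qed simp
  qed
qed

lemma num_proper_colourings_ge:
  fixes \<beta> :: real and L :: "'v \<Rightarrow> 'c set"
  assumes H: "hypergraph V E" "uniform r E" "list_assignment V c L"
    and deg: "\<And>v. v \<in> V \<Longrightarrow> degree E v \<le> \<Delta>"
    and r: "r \<ge> 2" and \<beta>: "\<beta> > 0" "\<beta> ^ (r - 1) + real \<Delta> \<le> real c * \<beta> ^ (r - 2)"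
  shows "\<beta> ^ card V \<le> real (num_proper_colourings V E L)"
proof -
  \<comment> \<open>An empty edge would be vacuously monochromatic; \<open>r \<ge> 2\<close>
    excludes it, so the unique function on the empty set counts as one proper colouring.\<close>
  have "induced_edges E {} = {}"
    using H(2) r by (force simp: induced_edges_def uniform_def)
  then have "card (induced_colourings E L {}) = 1"
    by (simp add: proper_colourings_def)
  moreover have "induced_edges E V = E"
    using H(1) by (auto simp: induced_edges_def hypergraph_def)
  ultimately show ?thesis
    using card_induced_colourings_diff[OF H deg r \<beta>, of V V]
    by (simp add: num_proper_colourings_def)
qed

theorem theorem2:
  fixes V :: "'v set" and E :: "'v set set" and r \<Delta> c :: nat
  assumes "r \<ge> 3" and "\<Delta> \<ge> 1"
    and "hypergraph V E" and "uniform r E" and "max_degree V E = \<Delta>"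
    and "c = nat \<lceil>((real r - 1) / (real r - 2))
                  * ((real r - 2) * real \<Delta>) powr (1 / (real r - 1))\<rceil>"
  shows "choosability V E \<le> c \<and>
    (\<forall>L :: 'v \<Rightarrow> 'c set. list_assignment V c L \<longrightarrow>
      real (num_proper_colourings V E L)
        \<ge> ((real r - 2) * real \<Delta>) powr (real (card V) / (real r - 1)))"
proof -
  define D where "D = (real r - 2) * real \<Delta>"
  \<comment> \<open>This value minimises x + \<Delta> / x^(r-2) over x > 0: the derivative vanishes
    when x^(r-1) = (r-2) \<Delta>. The minimum is \<beta> (r-1) / (r-2), whose ceiling is
    \<open>c\<close>.\<close>
  define \<beta> where "\<beta> = D powr (1 / (real r - 1))"
  have D: "D > 0" using assms(1,2) by (simp add: D_def)
  then have \<beta>: "\<beta> > 0" by (simp add: \<beta>_def)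
  have pow: "\<beta> ^ n = D powr (real n / (real r - 1))" for n
    using powr_realpow[OF \<beta>, of n] by (simp add: \<beta>_def powr_powr)
  have D_eq: "\<beta> ^ (r - 1) = D"
    using assms(1) D by (simp add: pow of_nat_diff)
  have r1: "r - 1 = Suc (r - 2)" using assms(1) by simp
  have c: "(real r - 1) / (real r - 2) * \<beta> \<le> real c"
    unfolding assms(6) \<beta>_def D_def by (rule real_nat_ceiling_ge)
  have "\<beta> ^ (r - 1) + real \<Delta> = (real r - 1) / (real r - 2) * D"
  proof -
    have "(real r - 1) / (real r - 2) * D = (real r - 1) * real \<Delta>"
      using assms(1) by (simp add: D_def)
    also have "\<dots> = D + real \<Delta>"
      by (simp add: D_def algebra_simps)
    finally show ?thesis using D_eq by simp
  qed
  also have "\<dots> = (real r - 1) / (real r - 2) * \<beta> * \<beta> ^ (r - 2)"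
    using D_eq unfolding r1 by simp
  also have "\<dots> \<le> real c * \<beta> ^ (r - 2)"
    using c \<beta> by (intro mult_right_mono) auto
  finally have ineq: "\<beta> ^ (r - 1) + real \<Delta> \<le> real c * \<beta> ^ (r - 2)" .
  have deg: "degree E v \<le> \<Delta>" if "v \<in> V" for v
    using assms(3,5) that by (auto simp: max_degree_def hypergraph_def intro: Max_ge)
  have r2: "r \<ge> 2" using assms(1) by simp
  \<comment> \<open>The counting bound is polymorphic in the colours: it is applied here to natural
    numbers, as \<open>choosable\<close> demands, and below to the type \<open>'c\<close>.
    Positivity of the bound gives existence.\<close>
  have "choosable V E c"
    unfolding choosable_def
  proof (intro allI impI)
    fix L :: "'v \<Rightarrow> nat set"
    assume "list_assignment V c L"
    then have "\<beta> ^ card V \<le> real (num_proper_colourings V E L)"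
      by (rule num_proper_colourings_ge[OF assms(3,4) _ deg r2 \<beta> ineq])
    moreover have "\<beta> ^ card V > 0" using \<beta> by simp
    ultimately show "proper_colourings V E L \<noteq> {}"
      by (auto simp: num_proper_colourings_def)
  qed
  then have "choosability V E \<le> c"
    unfolding choosability_def by (rule Least_le)
  moreover have "D powr (real (card V) / (real r - 1)) \<le> real (num_proper_colourings V E L)"
    if "list_assignment V c L" for L :: "'v \<Rightarrow> 'c set"
    using num_proper_colourings_ge[OF assms(3,4) that deg r2 \<beta> ineq] by (simp add: pow)
  ultimately show ?thesis
    unfolding D_def by blast
qed

end
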